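(* Let $\mathfrak{k}_1$ and $\mathfrak{k}_2$ be two fields equipped with the trivial norms. (a) $\mathbb{A}_{\mathfrak{k}_1}^1$ and $\mathbb{A}_{\mathfrak{k}_2}^1$ are homeomorphic if and only if the cardinality of $\mathfrak{k}_1[\mathbf{t}]_{\rm irr}$ equals that of $\mathfrak{k}_2[\mathbf{t}]_{\rm irr}$. (b) If both $\mathfrak{k}_1$ and $\mathfrak{k}_2$ are infinite (as sets), then $\mathbb{A}_{\mathfrak{k}_1}^1$ and $\mathbb{A}_{\mathfrak{k}_2}^1$ are homeomorphic if and only if $\mathfrak{k}_1$ and $\mathfrak{k}_2$ have the same cardinality. (c) If $\check{\mathfrak{k}}_1$ is the algebraic closure of $\mathfrak{k}_1$ (again endowed with the trivial norm), then $\mathbb{A}_{\mathfrak{k}_1}^1$ is homeomorphic to $\mathbb{A}_{\check{\mathfrak{k}}_1}^1$.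
   Context: For a field $\mathfrak{k}$ with the trivial norm, $\mathbb{A}_{\mathfrak{k}}^1$ is the set of all non-zero multiplicative seminorms on the polynomial ring $\mathfrak{k}[\mathbf{t}]$ whose restrictions to $\mathfrak{k}$ are contractive with respect to the trivial norm, with the topology of pointwise convergence. $\mathfrak{k}[\mathbf{t}]_{\rm irr}$ denotes the set of all monic irreducible polynomials in $\mathfrak{k}[\mathbf{t}]$. *)

theory Defs
  imports "HOL-Analysis.Analysis" "HOL-Computational_Algebra.Computational_Algebra"
    "HOL-Library.Equipollence"
begin

definition trivial_norm :: "'a::field \<Rightarrow> real"
  where "trivial_norm c = (if c = 0 then 0 else 1)"

definition multiplicative_seminorm :: "('r::comm_ring_1 \<Rightarrow> real) \<Rightarrow> bool"
  where "multiplicative_seminorm \<nu> \<longleftrightarrow>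
    (\<forall>f. 0 \<le> \<nu> f) \<and> \<nu> 0 = 0 \<and>
    (\<forall>f g. \<nu> (f + g) \<le> \<nu> f + \<nu> g) \<and>
    (\<forall>f g. \<nu> (f * g) = \<nu> f * \<nu> g)"

(* The field enters only through its type, passed as TYPE('a). *)
definition affine_line :: "'a::field itself \<Rightarrow> ('a poly \<Rightarrow> real) set"
  where "affine_line k = {\<nu>. multiplicative_seminorm \<nu> \<and> \<nu> \<noteq> (\<lambda>_. 0) \<and>
    (\<forall>c. \<nu> [:c:] \<le> trivial_norm c)}"

(* The topology of pointwise convergence is the one induced by the product topology. *)
definition affine_line_topology :: "'a::field itself \<Rightarrow> ('a poly \<Rightarrow> real) topology"
  where "affine_line_topology k = subtopology (powertop_real UNIV) (affine_line k)"

definition monic_irreducibles :: "'a::field itself \<Rightarrow> 'a poly set"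
  where "monic_irreducibles k = {p. lead_coeff p = 1 \<and> irreducible p}"

(* An algebraic closure is an extension, given by a field homomorphism, that is algebraic over
   the image of the base field and algebraically closed (the latter by the sort of the codomain). *)
definition is_algebraic_closure :: "('a::field \<Rightarrow> 'c::alg_closed_field) \<Rightarrow> bool"
  where "is_algebraic_closure \<iota> \<longleftrightarrow>
    \<iota> 1 = 1 \<and> (\<forall>x y. \<iota> (x + y) = \<iota> x + \<iota> y) \<and> (\<forall>x y. \<iota> (x * y) = \<iota> x * \<iota> y) \<and>
    (\<forall>z. \<exists>p. p \<noteq> 0 \<and> poly (map_poly \<iota> p) z = 0)"

end

theory Submission
  imports Defs
begin

text \<open>
  Over a trivially normed field \<open>k\<close> every point of the affine line is non-archimedean, and this
  leaves only three kinds of points. If \<open>\<nu> t > 1\<close>, then \<open>\<nu> f = \<nu> t ^ degree f\<close>. If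
  \<open>\<nu> t \<le> 1\<close>, then \<open>\<nu> \<le> 1\<close> everywhere, and by Bezout at most one monic irreducible \<open>p\<close> has
  \<open>\<nu> p < 1\<close>; then \<open>\<nu>\<close> is determined by \<open>\<nu> p\<close>, being \<open>p\<close>-adic. If there is no such \<open>p\<close>,
  then \<open>\<nu>\<close> is the trivial norm. So the affine line is a star: a half-open ray
  \<open>[1, \<infinity>)\<close>, and one closed unit spoke for each monic irreducible polynomial, all glued at the
  trivial norm.

  The topology is that of the star inside a product of lines as well
  (\<open>affine_line_homeomorphic_star\<close>). The coordinates \<open>max 1 (\<nu> t)\<close> and \<open>min 1 (\<nu> q)\<close> are
  continuous in \<open>\<nu>\<close>. Conversely the value at a monic irreducible \<open>q\<close> is
  \<open>max 1 (\<nu> t) ^ degree q * min 1 (\<nu> q)\<close> for every point of whatever kind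
  (\<open>affine_line_irreducible_value\<close>), so by multiplicativity each \<open>\<nu> f\<close> is a polynomial expression
  in finitely many coordinates, hence continuous in them.

  A star depends only on the cardinality of its set of spokes. Conversely this cardinality is a
  topological invariant: the points whose removal leaves the star connected are exactly the
  free ends of the spokes (\<open>noncut_points_star\<close>). This proves (a). For (b) and (c) it remains to
  count monic irreducibles: over an infinite field there are as many as there are scalars, and over
  any field there are infinitely many and as many as there are elements of an algebraic closure,
  because each has a root, roots of different ones differ, and each has finitely many.
\<close>

section \<open>Monic irreducible polynomials\<close>

lemma monic_irreduciblesD:
  assumes "q \<in> monic_irreducibles TYPE('a::field)"
  shows "lead_coeff q = 1" "irreducible q" "prime_elem q" "q \<noteq> 0" "degree q > 0"
proof -
  show *: "lead_coeff q = 1" "irreducible q"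
    using assms by (auto simp: monic_irreducibles_def)
  show "prime_elem q" using *(2) by (rule field_poly_irreducible_imp_prime)
  show "q \<noteq> 0" using *(1) by auto
  then show "degree q > 0"
    using irreducible_not_unit[OF *(2)] is_unit_iff_degree by blast
qed

lemma linear_monic_irreducible:
  "[:c, 1:] \<in> monic_irreducibles TYPE('a::field)"
  by (simp add: monic_irreducibles_def irreducible_linear_field_poly)

text \<open>
  Factorisation into irreducibles, in the form in which it serves multiplicative statements:
  a non-constant reducible polynomial splits into factors of smaller degree.
\<close>

lemma poly_factor_induct [case_names const irreducible mult]:
  fixes f :: "'a::field poly"
  assumes const: "\<And>c. P [:c:]"
    and irred: "\<And>q. q \<in> monic_irreducibles TYPE('a) \<Longrightarrow> P q"
    and mult: "\<And>f g. P f \<Longrightarrow> P g \<Longrightarrow> P (f * g)"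
  shows "P f"
proof (induction "degree f" arbitrary: f rule: less_induct)
  case less
  consider "degree f = 0" | "degree f > 0" "irreducible f" | "degree f > 0" "\<not> irreducible f"
    by blast
  then show ?case
  proof cases
    case 1
    then show ?thesis using const by (metis degree_eq_zeroE)
  next
    case 2
    \<comment> \<open>An irreducible polynomial is a unit multiple of a monic one.\<close>
    define q where "q = smult (inverse (lead_coeff f)) f"
    have lc: "lead_coeff f \<noteq> 0" using 2 by auto
    have f: "f = [:lead_coeff f:] * q" using lc by (simp add: q_def)
    have "is_unit [:lead_coeff f:]" using lc by (simp add: is_unit_pCons_iff)
    then have "irreducible q" using 2 f by (metis irreducible_mult_unit_left)
    moreover have "lead_coeff q = 1" using lc by (simp add: q_def)
    ultimately have "P q" using irred by (simp add: monic_irreducibles_def)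
    then show ?thesis using mult[OF const] f by metis
  next
    case 3
    have "f \<noteq> 0" using 3(1) by auto
    then have "\<not> is_unit f" using 3(1) is_unit_iff_degree[of f] by simp
    then obtain a b where ab: "f = a * b" "\<not> is_unit a" "\<not> is_unit b"
      using 3(2) \<open>f \<noteq> 0\<close> by (auto simp: irreducible_def)
    then have nz: "a \<noteq> 0" "b \<noteq> 0" using \<open>f \<noteq> 0\<close> by auto
    then have "degree a > 0" "degree b > 0" using ab is_unit_iff_degree by blast+
    then have "degree a < degree f" "degree b < degree f"
      using nz ab(1) by (simp_all add: degree_mult_eq)
    then show ?thesis using less mult ab(1) by blast
  qed
qed

lemma monic_irreducible_dvd_imp_eq:
  assumes "p \<in> monic_irreducibles TYPE('a::field)" "q \<in> monic_irreducibles TYPE('a)" "p dvd q"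
  shows "p = q"
proof -
  note p = monic_irreduciblesD[OF assms(1)] and q = monic_irreduciblesD[OF assms(2)]
  obtain m where m: "q = p * m" using assms(3) by blast
  then have "is_unit m" using q(2) p(2) irreducible_not_unit irreducibleD by metis
  then obtain c where "m = [:c:]" by (auto simp: is_unit_poly_iff)
  moreover have "lead_coeff m = 1" using m p q by (metis lead_coeff_mult mult_1)
  ultimately show ?thesis using m by (simp add: one_pCons)
qed

text \<open>
  An element of least degree in the ideal generated by \<open>p\<close> and \<open>q\<close> divides both, by division
  with remainder; a common divisor of two different monic irreducibles is a unit.
\<close>

lemma monic_irreducibles_bezout:
  assumes p: "p \<in> monic_irreducibles TYPE('a::field)" and q: "q \<in> monic_irreducibles TYPE('a)"
    and "p \<noteq> q"
  obtains a b where "a * p + b * q = 1"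
proof -
  define J where "J = {a * p + b * q | a b. True}"
  have "p \<in> J" "q \<in> J" unfolding J_def
    by (rule CollectI, rule exI[of _ 1], rule exI[of _ 0], simp,
        rule CollectI, rule exI[of _ 0], rule exI[of _ 1], simp)
  moreover note nz = monic_irreduciblesD(4)[OF p]
  ultimately obtain d where d: "d \<in> J" "d \<noteq> 0"
    and min: "\<And>e. e \<in> J \<Longrightarrow> e \<noteq> 0 \<Longrightarrow> degree d \<le> degree e"
    using ex_has_least_nat[of "\<lambda>e. e \<in> J \<and> e \<noteq> 0" p degree] by blast
  obtain a b where ab: "d = a * p + b * q" using d by (auto simp: J_def)
  have dvd: "d dvd f" if f_J: "f \<in> J" for f
  proof -
    obtain a' b' where f: "f = a' * p + b' * q" using f_J by (auto simp: J_def)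
    have "f mod d = f - (f div d) * d" by (simp add: minus_div_mult_eq_mod)
    also have "\<dots> = (a' - (f div d) * a) * p + (b' - (f div d) * b) * q"
      unfolding ab f by (simp add: algebra_simps)
    finally have "f mod d \<in> J" unfolding J_def by blast
    then have "f mod d = 0"
      using min[of "f mod d"] degree_mod_less'[OF d(2), of f] by force
    then show ?thesis by auto
  qed
  obtain k where k: "p = d * k" using dvd[OF \<open>p \<in> J\<close>] by blast
  have "\<not> is_unit k"
  proof
    assume "is_unit k"
    then have "p dvd d" using k by (metis mult_unit_dvd_iff dvd_refl)
    then have "p dvd q" using dvd[OF \<open>q \<in> J\<close>] dvd_trans by blast
    then show False using monic_irreducible_dvd_imp_eq p q \<open>p \<noteq> q\<close> by blast
  qed
  then have "is_unit d" using k monic_irreduciblesD(2)[OF p] irreducibleD by blast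
  then obtain e where "1 = d * e" by blast
  then have "(e * a) * p + (e * b) * q = 1" unfolding ab by (simp add: algebra_simps)
  then show ?thesis by (rule that)
qed

lemma ex_monic_irreducible_factor:
  fixes f :: "'a::field poly"
  shows "degree f > 0 \<Longrightarrow> \<exists>q \<in> monic_irreducibles TYPE('a). q dvd f"
proof (induction f rule: poly_factor_induct)
  case (mult f g)
  then have "f \<noteq> 0" "g \<noteq> 0" by auto
  then have "degree f > 0 \<or> degree g > 0" using mult(3) by (auto simp: degree_mult_eq)
  then show ?case using mult by (meson dvd_mult dvd_mult2)
qed (auto intro: dvd_refl)

text \<open>
  Euclid's argument.
\<close>

lemma infinite_monic_irreducibles: "infinite (monic_irreducibles TYPE('a::field))"
proof
  assume fin: "finite (monic_irreducibles TYPE('a))"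
  define f where "f = (\<Prod>q\<in>monic_irreducibles TYPE('a). q)"
  have nz: "f \<noteq> 0" unfolding f_def using fin monic_irreduciblesD(4) by (auto simp: prod_zero_iff)
  have dvd: "q dvd f" if "q \<in> monic_irreducibles TYPE('a)" for q
    unfolding f_def using fin that by (rule dvd_prodI)
  \<comment> \<open>The irreducible \<open>t\<close> divides the product \<open>f\<close>, so that \<open>1 + f\<close> is not constant.\<close>
  have t: "[:0, 1:] \<in> monic_irreducibles TYPE('a)" by (rule linear_monic_irreducible)
  have "degree f > 0"
    using dvd_imp_degree_le[OF dvd[OF t] nz] by simp
  then have "degree (1 + f) > 0" by (simp add: degree_add_eq_right)
  then obtain q where q: "q \<in> monic_irreducibles TYPE('a)" "q dvd 1 + f"
    using ex_monic_irreducible_factor by blast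
  then have "q dvd 1" using dvd by (metis dvd_add_left_iff)
  then show False using monic_irreduciblesD(2)[OF q(1)] irreducible_not_unit by blast
qed

section \<open>Counting monic irreducible polynomials\<close>

lemma infinite_times_lepoll:
  assumes "infinite A" shows "A \<times> A \<lesssim> A"
  using card_of_Times_same_infinite[OF assms] by (metis eqpoll_iff_card_of_ordIso eqpoll_imp_lepoll)

lemma infinite_UN_lepoll:
  assumes "infinite A" "I \<lesssim> A" "\<And>i. i \<in> I \<Longrightarrow> B i \<lesssim> A"
  shows "(\<Union>i\<in>I. B i) \<lesssim> A"
  using card_of_UNION_ordLeq_infinite[OF assms(1), of I B] assms(2,3)
  by (simp add: lepoll_def card_of_ordLeq)

text \<open>
  The polynomials of bounded degree inject into a finite power of the field, and a countable
  union of sets no larger than an infinite set is no larger either.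
\<close>

lemma polys_lepoll_infinite_field:
  assumes inf: "infinite (UNIV :: 'a::field set)"
  shows "(UNIV :: 'a poly set) \<lesssim> (UNIV :: 'a set)"
proof -
  have "{p :: 'a poly. degree p \<le> n} \<lesssim> (UNIV :: 'a set)" for n
  proof (induction n)
    case 0
    have "{p :: 'a poly. degree p \<le> 0} \<subseteq> (\<lambda>c. [:c:]) ` UNIV"
      by (auto elim!: degree_eq_zeroE)
    then show ?case by (meson image_lepoll lepoll_trans subset_imp_lepoll)
  next
    case (Suc n)
    have "{p :: 'a poly. degree p \<le> Suc n} \<lesssim> (\<lambda>(c, p). pCons c p) ` ((UNIV :: 'a set) \<times> {p. degree p \<le> n})"
    proof (rule subset_imp_lepoll, rule subsetI)
      fix p :: "'a poly" assume "p \<in> {p. degree p \<le> Suc n}"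
      moreover obtain c q where "p = pCons c q" by (rule pCons_cases)
      ultimately show "p \<in> (\<lambda>(c, p). pCons c p) ` ((UNIV :: 'a set) \<times> {p. degree p \<le> n})"
        by (auto split: if_splits)
    qed
    also have "\<dots> \<lesssim> (UNIV :: 'a set) \<times> {p :: 'a poly. degree p \<le> n}" by (rule image_lepoll)
    also have "\<dots> \<lesssim> (UNIV :: 'a set) \<times> (UNIV :: 'a set)"
      by (intro times_lepoll_mono Suc lepoll_refl)
    also have "\<dots> \<lesssim> (UNIV :: 'a set)" by (rule infinite_times_lepoll[OF inf])
    finally show ?case .
  qed
  then have "(\<Union>n\<in>(UNIV::nat set). {p :: 'a poly. degree p \<le> n}) \<lesssim> (UNIV :: 'a set)"
    using inf by (intro infinite_UN_lepoll) (auto simp: infinite_le_lepoll)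
  moreover have "(\<Union>n\<in>(UNIV::nat set). {p :: 'a poly. degree p \<le> n}) = UNIV" by auto
  ultimately show ?thesis by simp
qed

lemma field_lepoll_monic_irreducibles:
  "(UNIV :: 'a set) \<lesssim> monic_irreducibles TYPE('a::field)"
  unfolding lepoll_def
  by (rule exI[of _ "\<lambda>c. [:c, 1:]"]) (auto simp: inj_on_def linear_monic_irreducible)

lemma monic_irreducibles_eqpoll_infinite_field:
  assumes "infinite (UNIV :: 'a::field set)"
  shows "monic_irreducibles TYPE('a) \<approx> (UNIV :: 'a set)"
proof (rule lepoll_antisym[OF _ field_lepoll_monic_irreducibles])
  have "monic_irreducibles TYPE('a) \<lesssim> (UNIV :: 'a poly set)" by (simp add: subset_imp_lepoll)
  then show "monic_irreducibles TYPE('a) \<lesssim> (UNIV :: 'a set)"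
    using polys_lepoll_infinite_field[OF assms] by (rule lepoll_trans)
qed

text \<open>
  Evaluation of polynomials over \<open>'a\<close> at a point of an extension field is itself a ring
  homomorphism, and the comparison of irreducible polynomials with their roots uses only this.
\<close>

locale ring_hom_eval =
  fixes \<iota> :: "'a::field \<Rightarrow> 'c::field"
  assumes one: "\<iota> 1 = 1" and add: "\<iota> (x + y) = \<iota> x + \<iota> y" and mul: "\<iota> (x * y) = \<iota> x * \<iota> y"
begin

definition ev :: "'c \<Rightarrow> 'a poly \<Rightarrow> 'c"
  where "ev z p = poly (map_poly \<iota> p) z"

lemma zero [simp]: "\<iota> 0 = 0" using add[of 0 0] by (metis add_0 add_cancel_left_left)

lemma eq_zero_iff [simp]: "\<iota> x = 0 \<longleftrightarrow> x = 0"
  using mul[of x "inverse x"] one by (cases "x = 0") auto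

lemma ev_simps [simp]:
  "ev z 0 = 0" "ev z 1 = 1" "ev z (pCons c p) = \<iota> c + z * ev z p"
  "ev z (p + q) = ev z p + ev z q" "ev z (p * q) = ev z p * ev z q"
proof -
  show pc: "ev z (pCons c p) = \<iota> c + z * ev z p" for c p
    by (simp add: ev_def map_poly_pCons)
  show e0: "ev z 0 = 0" by (simp add: ev_def)
  show "ev z 1 = 1" by (simp add: one_pCons pc e0 one)
  show a: "ev z (p + q) = ev z p + ev z q" for p q
    by (induction p q rule: poly_induct2) (simp_all add: e0 pc add algebra_simps)
  have s: "ev z (smult c p) = \<iota> c * ev z p" for c p
    by (induction p) (simp_all add: e0 pc mul algebra_simps)
  show "ev z (p * q) = ev z p * ev z q"
    by (induction p) (simp_all add: e0 pc a s algebra_simps)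
qed

lemma common_root_imp_eq:
  assumes "p \<in> monic_irreducibles TYPE('a)" "q \<in> monic_irreducibles TYPE('a)"
    and "ev z p = 0" "ev z q = 0"
  shows "p = q"
proof (rule ccontr)
  assume "p \<noteq> q"
  then obtain a b where "a * p + b * q = 1" using monic_irreducibles_bezout assms(1,2) by blast
  then have "ev z (a * p + b * q) = 1" by simp
  then show False using assms(3,4) by simp
qed

lemma ex_irreducible_with_root:
  assumes "ev z f = 0" "f \<noteq> 0"
  shows "\<exists>q \<in> monic_irreducibles TYPE('a). ev z q = 0"
  using assms by (induction f rule: poly_factor_induct) auto

lemma finite_roots:
  assumes "p \<noteq> 0" shows "finite {z. ev z p = 0}"
  unfolding ev_def using assms by (intro poly_roots_finite) (simp add: map_poly_eq_0_iff)

end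

text \<open>
  Choosing a root is injective, because by Bezout different monic irreducibles have no common
  root. In the other direction, an algebraic closure is the union of the finite root sets of the
  monic irreducibles, which are infinitely many.
\<close>

lemma monic_irreducibles_eqpoll_algebraic_closure:
  fixes \<iota> :: "'a::field \<Rightarrow> 'c::alg_closed_field"
  assumes "is_algebraic_closure \<iota>"
  shows "monic_irreducibles TYPE('a) \<approx> (UNIV :: 'c set)"
proof -
  interpret ring_hom_eval \<iota>
    using assms by unfold_locales (auto simp: is_algebraic_closure_def)
  let ?I = "monic_irreducibles TYPE('a)"
  have "\<exists>z. ev z q = 0" if "q \<in> ?I" for q
  proof -
    have "degree (map_poly \<iota> q) = degree q" by (rule degree_map_poly) auto
    then show ?thesis
      using monic_irreduciblesD(5)[OF that] alg_closed_imp_poly_has_root unfolding ev_def by metis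
  qed
  then obtain root where root: "\<And>q. q \<in> ?I \<Longrightarrow> ev (root q) q = 0" by metis
  then have "inj_on root ?I"
    by (intro inj_onI) (metis common_root_imp_eq)
  then have le: "?I \<lesssim> (UNIV :: 'c set)" by (auto simp: lepoll_def)
  have "\<exists>q\<in>?I. ev z q = 0" for z
    using assms ex_irreducible_with_root[of z] unfolding is_algebraic_closure_def ev_def by blast
  then have "(UNIV :: 'c set) = (\<Union>q\<in>?I. {z. ev z q = 0})" by auto
  also have "\<dots> \<lesssim> ?I"
    using infinite_monic_irreducibles monic_irreduciblesD(4) finite_roots
    by (intro infinite_UN_lepoll lepoll_refl finite_lepoll_infinite) auto
  finally show ?thesis using le by (rule lepoll_antisym[rotated])
qed

lemma monic_irreducibles_eqpoll_alg_closed_field: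
  "monic_irreducibles TYPE('c) \<approx> (UNIV :: 'c::alg_closed_field set)"
proof (rule monic_irreducibles_eqpoll_algebraic_closure[of "\<lambda>x. x"])
  have "\<exists>p. p \<noteq> 0 \<and> poly p z = 0" for z :: 'c
    by (rule exI[of _ "[:-z, 1:]"]) simp
  then show "is_algebraic_closure (\<lambda>x::'c. x)"
    by (simp add: is_algebraic_closure_def map_poly_idI)
qed

section \<open>Stars\<close>

text \<open>
  In a point \<open>(r, x)\<close> of a star, \<open>r\<close> is the position on the ray and \<open>x i\<close> the position on the
  spoke \<open>i\<close>. Each coordinate is \<open>1\<close> at the centre \<open>ray 1\<close>, and only one coordinate can move away
  from \<open>1\<close>.
\<close>

definition ray :: "real \<Rightarrow> real \<times> ('i \<Rightarrow> real)"
  where "ray r = (r, \<lambda>_. 1)"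

definition spoke :: "'i \<Rightarrow> real \<Rightarrow> real \<times> ('i \<Rightarrow> real)"
  where "spoke i s = (1, (\<lambda>_. 1)(i := s))"

definition star :: "'i set \<Rightarrow> (real \<times> ('i \<Rightarrow> real)) set"
  where "star I = ray ` {1..} \<union> (\<Union>i\<in>I. spoke i ` {0..1})"

lemma spoke_1: "spoke i 1 = ray 1"
  by (simp add: spoke_def ray_def fun_eq_iff)

lemma ray_in_star: "1 \<le> r \<Longrightarrow> ray r \<in> star I"
  by (auto simp: star_def)

lemma spoke_in_star: "i \<in> I \<Longrightarrow> 0 \<le> s \<Longrightarrow> s \<le> 1 \<Longrightarrow> spoke i s \<in> star I"
  unfolding star_def by (intro UnI2 UN_I imageI) auto

text \<open>
  The centre is counted as a point of the ray, so that the two cases are disjoint.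
\<close>

lemma star_cases [consumes 1, case_names ray spoke]:
  assumes "y \<in> star I"
  obtains r where "y = ray r" "1 \<le> r" | i s where "i \<in> I" "y = spoke i s" "0 \<le> s" "s < 1"
proof -
  consider r where "y = ray r" "1 \<le> r" | i s where "i \<in> I" "y = spoke i s" "0 \<le> s" "s \<le> 1"
    using assms by (auto simp: star_def)
  then show ?thesis
  proof cases
    case 1 then show ?thesis by (rule that(1))
  next
    case (2 i s)
    then show ?thesis using that(1)[of 1] that(2)[of i s] by (cases "s = 1") (auto simp: spoke_1)
  qed
qed

lemma continuous_on_star_coordinate:
  "continuous_on S (\<lambda>y :: real \<times> ('i \<Rightarrow> real). snd y i)"
  by (rule continuous_on_product_then_coordinatewise) (intro continuous_intros)

lemma continuous_on_spoke: "continuous_on S (spoke i)"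
  unfolding spoke_def
proof (intro continuous_on_Pair continuous_on_coordinatewise_then_product continuous_intros)
  show "continuous_on S (\<lambda>s. ((\<lambda>_. 1)(i := s)) j)" for j
    by (cases "j = i") simp_all
qed

lemma continuous_on_ray: "continuous_on S ray"
  unfolding ray_def
  by (intro continuous_on_Pair continuous_on_coordinatewise_then_product continuous_intros)

text \<open>
  Pulls the spoke coordinates back along \<open>\<tau>\<close>. The default \<open>1\<close> outside \<open>K\<close> is the value that
  these coordinates have on every star with spokes in \<open>K\<close>.
\<close>

definition relabel :: "'x set \<Rightarrow> ('x \<Rightarrow> 'y) \<Rightarrow> real \<times> ('y \<Rightarrow> real) \<Rightarrow> real \<times> ('x \<Rightarrow> real)"
  where "relabel K \<tau> y = (fst y, \<lambda>k. if k \<in> K then snd y (\<tau> k) else 1)"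

lemma continuous_on_relabel: "continuous_on S (relabel K \<tau>)"
  unfolding relabel_def
proof (intro continuous_on_Pair continuous_on_coordinatewise_then_product continuous_intros)
  show "continuous_on S (\<lambda>x. if i \<in> K then snd x (\<tau> i) else 1)" for i
    by (cases "i \<in> K") (simp_all add: continuous_on_star_coordinate)
qed

lemma relabel_ray: "relabel K \<tau> (ray r) = ray r"
  by (auto simp: relabel_def ray_def)

lemma relabel_spoke:
  assumes "inj_on \<tau> K" "k \<in> K"
  shows "relabel K \<tau> (spoke (\<tau> k) s) = spoke k s"
  using assms by (auto simp: relabel_def spoke_def fun_eq_iff inj_on_def)

lemma star_homeomorphic_reindex:
  assumes "bij_betw \<sigma> I J"
  shows "star I homeomorphic star J"
proof -
  define \<tau> where "\<tau> = inv_into I \<sigma>"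
  have \<tau>: "bij_betw \<tau> J I" unfolding \<tau>_def by (rule bij_betw_inv_into[OF assms])
  have inj: "inj_on \<sigma> I" "inj_on \<tau> J" and mem: "\<And>i. i \<in> I \<Longrightarrow> \<sigma> i \<in> J" "\<And>j. j \<in> J \<Longrightarrow> \<tau> j \<in> I"
    using assms \<tau> by (auto simp: bij_betw_def)
  have inv: "\<tau> (\<sigma> i) = i" if "i \<in> I" for i
    unfolding \<tau>_def using inj(1) that by (rule inv_into_f_f)
  have inv': "\<sigma> (\<tau> j) = j" if "j \<in> J" for j
    unfolding \<tau>_def using assms that by (simp add: bij_betw_inv_into_right)
  have f: "relabel J \<tau> (spoke i s) = spoke (\<sigma> i) s" if "i \<in> I" for i s
    using relabel_spoke[OF inj(2) mem(1)[OF that]] inv[OF that] by simp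
  have g: "relabel I \<sigma> (spoke j s) = spoke (\<tau> j) s" if "j \<in> J" for j s
    using relabel_spoke[OF inj(1) mem(2)[OF that]] inv'[OF that] by simp
  have "relabel J \<tau> y \<in> star J \<and> relabel I \<sigma> (relabel J \<tau> y) = y" if "y \<in> star I" for y
    using that
    by (cases rule: star_cases) (use mem inv in \<open>auto simp: relabel_ray f g ray_in_star spoke_in_star\<close>)
  moreover have "relabel I \<sigma> y \<in> star I \<and> relabel J \<tau> (relabel I \<sigma> y) = y" if "y \<in> star J" for y
    using that
    by (cases rule: star_cases) (use mem inv' in \<open>auto simp: relabel_ray f g ray_in_star spoke_in_star\<close>)
  ultimately have "homeomorphism (star I) (star J) (relabel J \<tau>) (relabel I \<sigma>)"
    by (intro homeomorphismI continuous_on_relabel) auto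
  then show ?thesis by (auto simp: homeomorphic_def)
qed

text \<open>
  The cardinality of this set is a topological invariant. It recovers the number of spokes of a
  star, because each spoke contributes exactly its free end.
\<close>

definition noncut_points :: "'x::topological_space set \<Rightarrow> 'x set"
  where "noncut_points S = {y \<in> S. connected (S - {y})}"

lemma homeomorphic_imp_noncut_points_eqpoll:
  assumes "S homeomorphic T"
  shows "noncut_points S \<approx> noncut_points T"
proof -
  obtain f g where fg: "homeomorphism S T f g" using assms by (auto simp: homeomorphic_def)
  have sub: "f ` noncut_points S \<subseteq> noncut_points T" if "homeomorphism S T f g"
    for S :: "'x::topological_space set" and T :: "'y::topological_space set" and f g
  proof clarify
    fix y assume y: "y \<in> noncut_points S"
    have bij: "f ` S = T" "inj_on f S" and cont: "continuous_on S f"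
      using that by (auto simp: homeomorphism_def inj_on_def) metis
    have "f ` (S - {y}) = T - {f y}"
      using bij y by (auto simp: inj_on_image_set_diff noncut_points_def)
    moreover have "connected (f ` (S - {y}))"
      using y cont by (intro connected_continuous_image)
        (auto simp: noncut_points_def intro: continuous_on_subset)
    ultimately show "f y \<in> noncut_points T" using y bij by (auto simp: noncut_points_def)
  qed
  have "bij_betw f (noncut_points S) (noncut_points T)"
  proof (rule bij_betw_byWitness[of _ g])
    show "f ` noncut_points S \<subseteq> noncut_points T" by (rule sub[OF fg])
    show "g ` noncut_points T \<subseteq> noncut_points S" by (rule sub[OF homeomorphism_symD[OF fg]])
  qed (use fg in \<open>auto simp: homeomorphism_def noncut_points_def\<close>)
  then show ?thesis by (auto simp: eqpoll_def)
qed

text \<open>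
  What is left is still a union of intervals through the centre.
\<close>

lemma connected_star_minus_endpoint:
  assumes "i \<in> I" shows "connected (star I - {spoke i 0})"
proof -
  define C where "C j = (if j = i then {0<..1} else {0..1::real})" for j
  define F where "F = insert (ray ` {1..}) ((\<lambda>j. spoke j ` C j) ` I)"
  have "spoke j s = spoke i 0 \<longleftrightarrow> j = i \<and> s = 0" "ray r \<noteq> spoke i 0" for j r s
    by (auto simp: spoke_def ray_def fun_eq_iff split: if_splits)
  then have "star I - {spoke i 0} = \<Union>F"
    by (auto simp: star_def F_def C_def split: if_splits; force)
  moreover have "connected (\<Union>F)"
  proof (rule connected_Union)
    show "connected A" if "A \<in> F" for A
      using that unfolding F_def C_def
      by (auto intro!: connected_continuous_image continuous_on_spoke continuous_on_ray)
    have "ray 1 \<in> spoke j ` C j" for j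
      by (rule image_eqI[of _ _ 1]) (auto simp: spoke_1 C_def)
    then show "\<Inter>F \<noteq> {}" by (auto simp: F_def)
  qed
  ultimately show ?thesis by simp
qed

text \<open>
  Every other point separates its star: a point of the ray, including the centre, separates the
  part of the ray beyond it from the spokes, and an inner point of a spoke separates the free end
  of that spoke from the centre. The first of these fails for the centre if there are no spokes.
\<close>

lemma noncut_points_star:
  assumes "I \<noteq> {}"
  shows "noncut_points (star I) = (\<lambda>i. spoke i 0) ` I"
proof (intro equalityI subsetI)
  fix y assume "y \<in> (\<lambda>i. spoke i 0) ` I"
  then show "y \<in> noncut_points (star I)"
    using connected_star_minus_endpoint by (force simp: noncut_points_def spoke_in_star)
next
  fix y :: "real \<times> ('a \<Rightarrow> real)" assume y: "y \<in> noncut_points (star I)"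
  then have con: "connected (star I - {y})" and "y \<in> star I" by (auto simp: noncut_points_def)
  have op1: "open {z :: real \<times> ('a \<Rightarrow> real). fst z < r}" "open {z :: real \<times> ('a \<Rightarrow> real). fst z > r}" for r
    by (intro open_Collect_less continuous_intros)+
  have op2: "open {z :: real \<times> ('a \<Rightarrow> real). snd z i < s}" "open {z :: real \<times> ('a \<Rightarrow> real). snd z i > s}" for i s
    by (intro open_Collect_less continuous_on_star_coordinate continuous_intros)+
  have nonsep: False if "open U" "open V" "star I - {y} \<subseteq> U \<union> V" "U \<inter> V \<inter> (star I - {y}) = {}"
    "u \<in> U" "u \<in> star I" "u \<noteq> y" "v \<in> V" "v \<in> star I" "v \<noteq> y" for U V u v
    using con that unfolding connected_def by blast
  from \<open>y \<in> star I\<close> show "y \<in> (\<lambda>i. spoke i 0) ` I"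
  proof (cases rule: star_cases)
    case (ray r)
    obtain i where i: "i \<in> I" using assms by blast
    have mem: "ray (r + 1) \<in> star I" "spoke i 0 \<in> star I"
      using ray i by (simp_all add: ray_in_star spoke_in_star)
    let ?U = "{z :: real \<times> ('a \<Rightarrow> real). fst z > r}" and ?V = "{z :: real \<times> ('a \<Rightarrow> real). fst z < r} \<union> (\<Union>j. {z. snd z j < 1})"
    have "False"
    proof (rule nonsep[of ?U ?V "ray (r + 1)" "spoke i 0"])
      show "open ?V" using op1 op2 by (intro open_Un open_UN) auto
      show "star I - {y} \<subseteq> ?U \<union> ?V"
      proof
        fix z assume z: "z \<in> star I - {y}"
        then have "z \<in> star I" by simp
        then show "z \<in> ?U \<union> ?V"
          by (cases rule: star_cases) (use z ray in \<open>auto simp: ray_def spoke_def\<close>)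
      qed
      have "fst z \<le> r" if "snd z j < 1" "z \<in> star I" for z j
        using that(2)
        by (cases rule: star_cases) (use that(1) ray in \<open>auto simp: ray_def spoke_def\<close>)
      then show "?U \<inter> ?V \<inter> (star I - {y}) = {}" by force
    qed (use ray mem op1 in \<open>auto simp: ray_def spoke_def fun_eq_iff\<close>)
    then show ?thesis ..
  next
    case (spoke i s)
    show ?thesis
    proof (cases "s = 0")
      case False
      have mem: "spoke i 0 \<in> star I" "ray 1 \<in> star I"
        using spoke by (simp_all add: ray_in_star spoke_in_star)
      let ?U = "{z :: real \<times> ('a \<Rightarrow> real). snd z i < s}" and ?V = "{z :: real \<times> ('a \<Rightarrow> real). snd z i > s}"
      have False
      proof (rule nonsep[of ?U ?V "spoke i 0" "ray 1"])
        show "star I - {y} \<subseteq> ?U \<union> ?V"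
        proof
          fix z assume z: "z \<in> star I - {y}"
          then have "z \<in> star I" by simp
          then show "z \<in> ?U \<union> ?V"
            by (cases rule: star_cases) (use z spoke in \<open>auto simp: ray_def spoke_def\<close>)
        qed
      qed (use spoke False mem op2 in \<open>auto simp: ray_def spoke_def fun_eq_iff split: if_splits\<close>)
      then show ?thesis ..
    qed (use spoke in auto)
  qed
qed

lemma star_homeomorphic_iff:
  assumes "I \<noteq> {}" "J \<noteq> {}"
  shows "star I homeomorphic star J \<longleftrightarrow> I \<approx> J"
proof
  have ends: "noncut_points (star K) \<approx> K" if "K \<noteq> {}" for K :: "'x set"
  proof -
    have "inj_on (\<lambda>i. spoke i 0) K" by (auto simp: inj_on_def spoke_def fun_eq_iff split: if_splits)
    then show ?thesis by (simp add: noncut_points_star[OF that] inj_on_image_eqpoll_self)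
  qed
  assume "star I homeomorphic star J"
  then show "I \<approx> J"
    using ends[OF assms(1)] ends[OF assms(2)] homeomorphic_imp_noncut_points_eqpoll
    by (meson eqpoll_sym eqpoll_trans)
next
  assume "I \<approx> J"
  then show "star I homeomorphic star J" by (auto simp: eqpoll_def intro: star_homeomorphic_reindex)
qed

section \<open>Multiplicative seminorms on the polynomial ring\<close>

text \<open>
  A linear factor is too small to matter against exponential growth.
\<close>

lemma real_le_if_powers_le:
  fixes x M :: real
  assumes "0 \<le> M" "\<And>n. x ^ n \<le> (real n + 1) * M ^ n"
  shows "x \<le> M"
proof (rule ccontr)
  assume "\<not> x \<le> M"
  then have "x > M" by simp
  have "M \<noteq> 0" using assms(2)[of 1] \<open>x > M\<close> by auto
  then have "M > 0" using assms(1) by simp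
  define y where "y = x / M"
  have "y > 1" using \<open>x > M\<close> \<open>M > 0\<close> by (simp add: y_def)
  have "(\<lambda>n. real n / y ^ n + 1 / y ^ n) \<longlonglongrightarrow> 0 + 0"
  proof (intro tendsto_add)
    show "(\<lambda>n. real n / y ^ n) \<longlonglongrightarrow> 0"
      using lim_n_over_pown[of y] \<open>y > 1\<close> by simp
    show "(\<lambda>n. 1 / y ^ n) \<longlonglongrightarrow> 0"
      using LIMSEQ_inverse_realpow_zero[of y] \<open>y > 1\<close> by (simp add: divide_inverse)
  qed
  then have "eventually (\<lambda>n. real n / y ^ n + 1 / y ^ n < 1) sequentially"
    by (rule order_tendstoD) simp
  then obtain n where "real n / y ^ n + 1 / y ^ n < 1"
    by (auto simp: eventually_sequentially)
  then have "real n + 1 < y ^ n" using \<open>y > 1\<close> by (simp add: field_simps)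
  moreover have "y ^ n \<le> real n + 1"
    using assms(2)[of n] \<open>M > 0\<close> by (simp add: y_def power_divide field_simps)
  ultimately show False by simp
qed

text \<open>
  Contractivity on constants is equality: the values at \<open>c\<close> and at \<open>inverse c\<close> are at most \<open>1\<close>
  and their product is \<open>1\<close>.
\<close>

lemma affine_lineD:
  assumes "\<nu> \<in> affine_line TYPE('a::field)"
  shows "0 \<le> \<nu> f" "\<nu> 0 = 0" "\<nu> (f + g) \<le> \<nu> f + \<nu> g" "\<nu> (f * g) = \<nu> f * \<nu> g"
    and "\<nu> 1 = 1" "\<nu> [:c:] = trivial_norm c" "\<nu> (f ^ n) = \<nu> f ^ n"
proof -
  show *: "0 \<le> \<nu> f" "\<nu> 0 = 0" "\<nu> (f + g) \<le> \<nu> f + \<nu> g" "\<nu> (f * g) = \<nu> f * \<nu> g" for f g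
    using assms by (auto simp: affine_line_def multiplicative_seminorm_def)
  obtain h where "\<nu> h \<noteq> 0" using assms by (auto simp: affine_line_def fun_eq_iff)
  then show 1: "\<nu> 1 = 1" using *(4)[of h 1] by simp
  have le: "\<nu> [:c:] \<le> trivial_norm c" for c using assms by (auto simp: affine_line_def)
  show "\<nu> [:c:] = trivial_norm c"
  proof (cases "c = 0")
    case False
    have "\<nu> [:c:] * \<nu> [:inverse c:] = 1"
      using *(4)[of "[:c:]" "[:inverse c:]"] 1 False by (simp add: one_pCons)
    moreover have "\<nu> [:c:] \<le> 1" "\<nu> [:inverse c:] \<le> 1"
      using le[of c] le[of "inverse c"] False by (simp_all add: trivial_norm_def)
    ultimately have "\<nu> [:c:] = 1"
      using *(1)[of "[:c:]"] mult_left_le[of "\<nu> [:inverse c:]" "\<nu> [:c:]"] by simp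
    then show ?thesis using False by (simp add: trivial_norm_def)
  qed (simp add: *(2) trivial_norm_def)
  show "\<nu> (f ^ n) = \<nu> f ^ n" by (induction n) (simp_all add: 1 *(4))
qed

text \<open>
  The usual argument for the strong triangle inequality: binomial coefficients are constants, so
  they have norm at most \<open>1\<close>, and the binomial theorem gives
  \<open>\<nu> (f + g) ^ n \<le> (n + 1) * max (\<nu> f) (\<nu> g) ^ n\<close> for all \<open>n\<close>.
\<close>

lemma affine_line_ultrametric:
  assumes "\<nu> \<in> affine_line TYPE('a::field)"
  shows "\<nu> (f + g) \<le> max (\<nu> f) (\<nu> g)"
proof (rule real_le_if_powers_le)
  note D = affine_lineD[OF assms]
  let ?M = "max (\<nu> f) (\<nu> g)"
  have M: "0 \<le> ?M" using D(1)[of f] by simp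
  then show "0 \<le> ?M" .
  fix n
  have sum_le: "\<nu> (sum h A) \<le> (\<Sum>k\<in>A. \<nu> (h k))" if "finite A" for h :: "nat \<Rightarrow> 'a poly" and A
    using that by induction (auto simp: D(2) intro: order_trans[OF D(3)])
  have "\<nu> (f + g) ^ n = \<nu> (\<Sum>k\<le>n. of_nat (n choose k) * f ^ k * g ^ (n - k))"
    by (simp add: D(7)[symmetric] binomial_ring)
  also have "\<dots> \<le> (\<Sum>k\<le>n. \<nu> (of_nat (n choose k) * f ^ k * g ^ (n - k)))"
    by (rule sum_le) simp
  also have "\<dots> \<le> (\<Sum>k\<le>n. ?M ^ n)"
  proof (rule sum_mono)
    fix k assume k: "k \<in> {..n}"
    have "\<nu> (of_nat (n choose k)) \<le> 1"
      by (simp add: of_nat_poly D(6) trivial_norm_def)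
    then have "\<nu> (of_nat (n choose k) * f ^ k * g ^ (n - k)) \<le> 1 * ?M ^ k * ?M ^ (n - k)"
      unfolding D(4) D(7) using M by (intro mult_mono power_mono mult_nonneg_nonneg zero_le_power D(1)) auto
    then show "\<nu> (of_nat (n choose k) * f ^ k * g ^ (n - k)) \<le> ?M ^ n"
      using k by (simp flip: power_add)
  qed
  also have "\<dots> = (real n + 1) * ?M ^ n" by simp
  finally show "\<nu> (f + g) ^ n \<le> (real n + 1) * ?M ^ n" .
qed

lemma affine_line_le_1:
  assumes \<nu>: "\<nu> \<in> affine_line TYPE('a::field)" and "\<nu> [:0, 1:] \<le> 1"
  shows "\<nu> f \<le> 1"
proof (induction f)
  case 0
  show ?case by (simp add: affine_lineD(2)[OF \<nu>])
next
  case (pCons c f)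
  note D = affine_lineD[OF \<nu>]
  have "pCons c f = [:c:] + [:0, 1:] * f" by simp
  then have "\<nu> (pCons c f) \<le> max (trivial_norm c) (\<nu> [:0, 1:] * \<nu> f)"
    using affine_line_ultrametric[OF \<nu>, of "[:c:]" "[:0, 1:] * f"] D(4,6) by metis
  also have "\<dots> \<le> 1"
    using assms(2) pCons D(1) mult_mono[of "\<nu> [:0, 1:]" 1 "\<nu> f" 1] by (simp add: trivial_norm_def)
  finally show ?case .
qed

text \<open>
  In Horner form \<open>c + t * f\<close> with \<open>f \<noteq> 0\<close> the second summand has norm greater than \<open>1\<close> and dominates the
  constant, so the strong triangle inequality is an equality.
\<close>

lemma affine_line_eq_power_degree:
  assumes \<nu>: "\<nu> \<in> affine_line TYPE('a::field)" and gt: "\<nu> [:0, 1:] > 1" and "f \<noteq> 0"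
  shows "\<nu> f = \<nu> [:0, 1:] ^ degree f"
  using \<open>f \<noteq> 0\<close>
proof (induction f)
  case (pCons c f)
  note D = affine_lineD[OF \<nu>]
  let ?t = "[:0, 1:] :: 'a poly"
  show ?case
  proof (cases "f = 0")
    case True
    then show ?thesis using pCons by (simp add: D(6) trivial_norm_def)
  next
    case False
    have c: "trivial_norm c \<le> 1" by (simp add: trivial_norm_def)
    have tf: "\<nu> (?t * f) = \<nu> ?t ^ Suc (degree f)" using pCons False by (simp only: D(4)) simp
    have "1 < \<nu> ?t ^ Suc (degree f)" using gt by (rule one_less_power) simp
    then have big: "1 < \<nu> (?t * f)" unfolding tf .
    have eq: "pCons c f = [:c:] + ?t * f" "?t * f = [:- c:] + pCons c f" by simp_all
    have "\<nu> (pCons c f) \<le> \<nu> (?t * f)"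
      using affine_line_ultrametric[OF \<nu>, of "[:c:]" "?t * f"] c big
      unfolding eq(1)[symmetric] D(6) by linarith
    moreover have "trivial_norm (- c) \<le> 1" by (simp add: trivial_norm_def)
    then have "\<nu> (?t * f) \<le> \<nu> (pCons c f)"
      using affine_line_ultrametric[OF \<nu>, of "[:- c:]" "pCons c f"] big
      unfolding eq(2)[symmetric] D(6) by linarith
    ultimately show ?thesis using tf False by simp
  qed
qed simp

text \<open>
  One formula covers all kinds of points. It expresses the value at an irreducible, and so by
  multiplicativity every value, through the two coordinates that make up \<open>star_coords\<close>; this is
  what makes those coordinates injective and their inverse continuous.
\<close>

lemma affine_line_irreducible_value:
  assumes \<nu>: "\<nu> \<in> affine_line TYPE('a::field)" and q: "q \<in> monic_irreducibles TYPE('a)"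
  shows "\<nu> q = max 1 (\<nu> [:0, 1:]) ^ degree q * min 1 (\<nu> q)"
proof (cases "\<nu> [:0, 1:] > 1")
  case True
  then have eq: "\<nu> q = \<nu> [:0, 1:] ^ degree q"
    using affine_line_eq_power_degree \<nu> monic_irreduciblesD(4)[OF q] by blast
  have "1 \<le> \<nu> [:0, 1:] ^ degree q" using True by (intro one_le_power) simp
  then show ?thesis using True eq by simp
next
  case False
  then show ?thesis using affine_line_le_1[OF \<nu>, of q] by (simp add: max_def)
qed

text \<open>
  Otherwise \<open>p\<close> and \<open>q\<close> would have a combination \<open>a * p + b * q = 1\<close> whose norm is less than \<open>1\<close>,
  since the coefficients have norm at most \<open>1\<close>.
\<close>

lemma affine_line_at_most_one_small:
  assumes \<nu>: "\<nu> \<in> affine_line TYPE('a::field)"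
    and p: "p \<in> monic_irreducibles TYPE('a)" "\<nu> p < 1"
    and q: "q \<in> monic_irreducibles TYPE('a)" "\<nu> q < 1"
    and t: "\<nu> [:0, 1:] \<le> 1"
  shows "p = q"
proof (rule ccontr)
  note D = affine_lineD[OF \<nu>]
  assume "p \<noteq> q"
  then obtain a b where ab: "a * p + b * q = 1" using monic_irreducibles_bezout p(1) q(1) by blast
  have "\<nu> (h * f) \<le> \<nu> f" for h f
    unfolding D(4) by (rule mult_left_le_one_le[OF D(1) D(1) affine_line_le_1[OF \<nu> t]])
  then have "\<nu> (a * p) < 1" "\<nu> (b * q) < 1"
    using p(2) q(2) le_less_trans by blast+
  then show False using affine_line_ultrametric[OF \<nu>, of "a * p" "b * q"] by (simp add: ab D(5))
qed

definition degree_seminorm :: "real \<Rightarrow> 'a::field poly \<Rightarrow> real"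
  where "degree_seminorm r f = (if f = 0 then 0 else r ^ degree f)"

lemma degree_seminorm_in_affine_line:
  assumes "1 \<le> r" shows "degree_seminorm r \<in> affine_line TYPE('a::field)"
  unfolding affine_line_def multiplicative_seminorm_def
proof (intro CollectI conjI allI)
  show "0 \<le> degree_seminorm r f" for f :: "'a poly"
    using assms by (simp add: degree_seminorm_def)
  show "degree_seminorm r (f + g) \<le> degree_seminorm r f + degree_seminorm r g" for f g :: "'a poly"
  proof (cases "f = 0 \<or> g = 0 \<or> f + g = 0")
    case False
    then have "r ^ degree (f + g) \<le> r ^ max (degree f) (degree g)"
      using assms by (intro power_increasing degree_add_le_max)
    also have "\<dots> \<le> r ^ degree f + r ^ degree g" using assms by (simp add: max_def)
    finally show ?thesis using False by (simp add: degree_seminorm_def)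
  qed (use assms in \<open>auto simp: degree_seminorm_def\<close>)
  show "degree_seminorm r (f * g) = degree_seminorm r f * degree_seminorm r g" for f g :: "'a poly"
    by (simp add: degree_seminorm_def degree_mult_eq power_add)
  show "degree_seminorm r \<noteq> (\<lambda>_::'a poly. 0)"
    by (rule notI, drule fun_cong[of _ _ 1]) (simp add: degree_seminorm_def)
qed (simp_all add: degree_seminorm_def trivial_norm_def)

text \<open>
  The exponent of \<open>p\<close> in \<open>f\<close>, as the analogue of \<open>order\<close> for a prime of any degree.
\<close>

definition vanishing_order :: "'a::field poly \<Rightarrow> 'a poly \<Rightarrow> nat"
  where "vanishing_order p f = (LEAST n. \<not> p ^ Suc n dvd f)"

lemma vanishing_order_eqI:
  assumes "p \<noteq> 0" "\<not> p dvd g"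
  shows "vanishing_order p (p ^ n * g) = n"
  unfolding vanishing_order_def
proof (rule Least_equality)
  show "\<not> p ^ Suc n dvd p ^ n * g" using assms by simp
  show "n \<le> m" if "\<not> p ^ Suc m dvd p ^ n * g" for m
  proof (rule ccontr)
    assume "\<not> n \<le> m"
    then have "p ^ Suc m dvd p ^ n" by (intro le_imp_power_dvd) simp
    then show False using that by simp
  qed
qed

lemma vanishing_order_decompose:
  assumes p: "p \<in> monic_irreducibles TYPE('a::field)" and "f \<noteq> 0"
  obtains g where "f = p ^ vanishing_order p f * g" "\<not> p dvd g"
proof -
  have "\<exists>n g. f = p ^ n * g \<and> \<not> p dvd g"
    using \<open>f \<noteq> 0\<close>
  proof (induction "degree f" arbitrary: f rule: less_induct)
    case less
    show ?case
    proof (cases "p dvd f")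
      case True
      then obtain h where h: "f = p * h" by blast
      then have "h \<noteq> 0" "degree h < degree f"
        using less(2) monic_irreduciblesD[OF p] by (auto simp: degree_mult_eq)
      then obtain n g where "h = p ^ n * g" "\<not> p dvd g" using less(1) by blast
      then have "f = p ^ Suc n * g \<and> \<not> p dvd g" using h by (simp add: mult.assoc)
      then show ?thesis by blast
    next
      case False
      then have "f = p ^ 0 * f \<and> \<not> p dvd f" by simp
      then show ?thesis by blast
    qed
  qed
  then show ?thesis using vanishing_order_eqI monic_irreduciblesD(4)[OF p] that by metis
qed

lemma vanishing_order_ge:
  assumes p: "p \<in> monic_irreducibles TYPE('a::field)" and "f \<noteq> 0" "p ^ n dvd f"
  shows "n \<le> vanishing_order p f"
proof (rule ccontr)
  obtain g where g: "f = p ^ vanishing_order p f * g" "\<not> p dvd g"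
    using vanishing_order_decompose[OF p \<open>f \<noteq> 0\<close>] .
  assume "\<not> n \<le> vanishing_order p f"
  then have "p ^ Suc (vanishing_order p f) dvd p ^ n" by (intro le_imp_power_dvd) simp
  then have "p ^ Suc (vanishing_order p f) dvd p ^ vanishing_order p f * g"
    using g(1) assms(3) by (metis dvd_trans)
  then show False using g(2) monic_irreduciblesD(4)[OF p] by simp
qed

lemma vanishing_order_mult:
  assumes p: "p \<in> monic_irreducibles TYPE('a::field)" and "f \<noteq> 0" "g \<noteq> 0"
  shows "vanishing_order p (f * g) = vanishing_order p f + vanishing_order p g"
proof -
  obtain f' where f': "f = p ^ vanishing_order p f * f'" "\<not> p dvd f'"
    using vanishing_order_decompose[OF p \<open>f \<noteq> 0\<close>] .
  obtain g' where g': "g = p ^ vanishing_order p g * g'" "\<not> p dvd g'"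
    using vanishing_order_decompose[OF p \<open>g \<noteq> 0\<close>] .
  have "f * g = p ^ (vanishing_order p f + vanishing_order p g) * (f' * g')"
    by (subst f'(1), subst g'(1)) (simp add: power_add mult_ac)
  moreover have "\<not> p dvd f' * g'"
    using f'(2) g'(2) monic_irreduciblesD(3)[OF p] by (simp add: prime_elem_dvd_mult_iff)
  ultimately show ?thesis using vanishing_order_eqI monic_irreduciblesD(4)[OF p] by metis
qed

lemma vanishing_order_eq_0: "\<not> p dvd f \<Longrightarrow> vanishing_order p f = 0"
  unfolding vanishing_order_def by (rule Least_eq_0) simp

text \<open>
  For \<open>s = 0\<close> the convention \<open>0 ^ 0 = 1\<close> gives the seminorm with kernel generated by \<open>p\<close>, so
  the free end of a spoke needs no separate treatment.
\<close>

definition adic_seminorm :: "'a::field poly \<Rightarrow> real \<Rightarrow> 'a poly \<Rightarrow> real"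
  where "adic_seminorm p s f = (if f = 0 then 0 else s ^ vanishing_order p f)"

lemma adic_seminorm_in_affine_line:
  assumes p: "p \<in> monic_irreducibles TYPE('a::field)" and s: "0 \<le> s" "s \<le> 1"
  shows "adic_seminorm p s \<in> affine_line TYPE('a::field)"
  unfolding affine_line_def multiplicative_seminorm_def
proof (intro CollectI conjI allI)
  show "0 \<le> adic_seminorm p s f" for f
    using s by (simp add: adic_seminorm_def)
  show "adic_seminorm p s (f + g) \<le> adic_seminorm p s f + adic_seminorm p s g" for f g
  proof (cases "f = 0 \<or> g = 0 \<or> f + g = 0")
    case False
    let ?m = "min (vanishing_order p f) (vanishing_order p g)"
    have pow_dvd: "p ^ m dvd h" if "h \<noteq> 0" "m \<le> vanishing_order p h" for h m
      using vanishing_order_decompose[OF p that(1)] le_imp_power_dvd[OF that(2)] by (metis dvd_mult2)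
    have "p ^ ?m dvd f + g" using False by (intro dvd_add pow_dvd) simp_all
    then have "?m \<le> vanishing_order p (f + g)" using vanishing_order_ge[OF p] False by blast
    then have "s ^ vanishing_order p (f + g) \<le> s ^ ?m" using s by (intro power_decreasing)
    also have "\<dots> \<le> s ^ vanishing_order p f + s ^ vanishing_order p g"
      using s by (simp add: min_def)
    finally show ?thesis using False by (simp add: adic_seminorm_def)
  qed (use s in \<open>auto simp: adic_seminorm_def\<close>)
  show "adic_seminorm p s (f * g) = adic_seminorm p s f * adic_seminorm p s g" for f g
    by (simp add: adic_seminorm_def vanishing_order_mult[OF p] power_add)
  have const: "vanishing_order p [:c:] = 0" if "c \<noteq> 0" for c
  proof (rule vanishing_order_eq_0, rule notI)
    assume "p dvd [:c:]"
    then have "degree p \<le> degree [:c:]" using that by (intro dvd_imp_degree_le) simp_all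
    then show False using monic_irreduciblesD(5)[OF p] by simp
  qed
  show "adic_seminorm p s \<noteq> (\<lambda>_. 0)"
    by (rule notI, drule fun_cong[of _ _ 1]) (simp add: adic_seminorm_def const one_pCons)
  show "adic_seminorm p s [:c:] \<le> trivial_norm c" for c
    by (simp add: adic_seminorm_def trivial_norm_def const)
qed (simp add: adic_seminorm_def)

lemma adic_seminorm_irreducible:
  assumes "p \<in> monic_irreducibles TYPE('a::field)" "q \<in> monic_irreducibles TYPE('a)"
  shows "adic_seminorm p s q = (if q = p then s else 1)"
proof -
  note p = monic_irreduciblesD[OF assms(1)]
  have "\<not> p dvd 1" using p(2) irreducible_not_unit by blast
  then have "vanishing_order p p = 1" using vanishing_order_eqI[of p 1 1] p(4) by simp
  moreover have "vanishing_order p q = 0" if "q \<noteq> p"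
    using that monic_irreducible_dvd_imp_eq[OF assms] by (intro vanishing_order_eq_0) auto
  ultimately show ?thesis using p(4) monic_irreduciblesD(4)[OF assms(2)] by (simp add: adic_seminorm_def)
qed

definition star_coords :: "('a::field poly \<Rightarrow> real) \<Rightarrow> real \<times> ('a poly \<Rightarrow> real)"
  where "star_coords \<nu> = (max 1 (\<nu> [:0, 1:]),
    \<lambda>q. if q \<in> monic_irreducibles TYPE('a) then min 1 (\<nu> q) else 1)"

lemma affine_line_eqI:
  assumes \<nu>: "\<nu> \<in> affine_line TYPE('a::field)" and \<mu>: "\<mu> \<in> affine_line TYPE('a)"
    and eq: "star_coords \<nu> = star_coords \<mu>"
  shows "\<nu> = \<mu>"
proof
  fix f show "\<nu> f = \<mu> f"
  proof (induction f rule: poly_factor_induct)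
    case (irreducible q)
    then have "min 1 (\<nu> q) = min 1 (\<mu> q)" "max 1 (\<nu> [:0, 1:]) = max 1 (\<mu> [:0, 1:])"
      using eq by (auto simp: star_coords_def dest!: fun_cong[of _ _ q])
    then show ?case
      using affine_line_irreducible_value[OF \<nu> irreducible]
        affine_line_irreducible_value[OF \<mu> irreducible] by simp
  qed (simp_all add: affine_lineD[OF \<nu>] affine_lineD[OF \<mu>])
qed

lemma star_coords_degree_seminorm:
  "1 \<le> r \<Longrightarrow> star_coords (degree_seminorm r :: 'a::field poly \<Rightarrow> real) = ray r"
  using one_le_power[of r] monic_irreduciblesD(4)
  by (auto simp: star_coords_def ray_def degree_seminorm_def fun_eq_iff)

lemma star_coords_adic_seminorm:
  assumes p: "p \<in> monic_irreducibles TYPE('a::field)" and s: "0 \<le> s" "s \<le> 1"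
  shows "star_coords (adic_seminorm p s) = spoke p s"
  using s p adic_seminorm_irreducible[OF p linear_monic_irreducible, of s 0]
  by (auto simp: star_coords_def spoke_def adic_seminorm_irreducible fun_eq_iff)

text \<open>
  This is the classification of the points: at most one coordinate differs from \<open>1\<close>.
\<close>

lemma star_coords_in_star:
  assumes \<nu>: "\<nu> \<in> affine_line TYPE('a::field)"
  shows "star_coords \<nu> \<in> star (monic_irreducibles TYPE('a))"
proof (cases "\<exists>p \<in> monic_irreducibles TYPE('a). \<nu> p < 1")
  case False
  then have "star_coords \<nu> = ray (max 1 (\<nu> [:0, 1:]))"
    by (auto simp: star_coords_def ray_def fun_eq_iff not_less)
  then show ?thesis by (simp add: ray_in_star)
next
  case True
  then obtain p where p: "p \<in> monic_irreducibles TYPE('a)" "\<nu> p < 1" by blast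
  have t: "\<nu> [:0, 1:] \<le> 1"
  proof (rule ccontr)
    assume *: "\<not> \<nu> [:0, 1:] \<le> 1"
    then have "\<nu> p = \<nu> [:0, 1:] ^ degree p"
      by (intro affine_line_eq_power_degree[OF \<nu>] monic_irreduciblesD(4)[OF p(1)]) simp
    moreover have "1 \<le> \<nu> [:0, 1:] ^ degree p" using * by (intro one_le_power) simp
    ultimately show False using p(2) by linarith
  qed
  have "1 \<le> \<nu> q" if "q \<in> monic_irreducibles TYPE('a)" "q \<noteq> p" for q
    using affine_line_at_most_one_small[OF \<nu> p that(1) _ t] that(2) by force
  then have "star_coords \<nu> = spoke p (\<nu> p)"
    using p t by (auto simp: star_coords_def spoke_def fun_eq_iff)
  then show ?thesis using p affine_lineD(1)[OF \<nu>] by (simp add: spoke_in_star)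
qed

text \<open>
  The coordinates are onto the star because of the degree seminorms and the \<open>p\<close>-adic ones. The
  inverse is continuous if each value \<open>\<nu> f\<close> depends continuously on the coordinates; the set of
  these \<open>f\<close> contains the constants and the irreducibles and is closed under products.
\<close>

lemma affine_line_homeomorphic_star:
  "affine_line TYPE('a::field) homeomorphic star (monic_irreducibles TYPE('a))"
proof -
  let ?A = "affine_line TYPE('a)" and ?S = "star (monic_irreducibles TYPE('a))"
  have inj: "inj_on star_coords ?A" by (rule inj_onI) (rule affine_line_eqI)
  have "y \<in> star_coords ` ?A" if "y \<in> ?S" for y
    using that
  proof (cases rule: star_cases)
    case (ray r)
    then show ?thesis
      using degree_seminorm_in_affine_line star_coords_degree_seminorm by (metis imageI)
  next
    case (spoke p s)
    then show ?thesis
      using adic_seminorm_in_affine_line[of p s] star_coords_adic_seminorm[of p s] by (metis imageI less_imp_le)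
  qed
  then have img: "star_coords ` ?A = ?S" using star_coords_in_star by blast
  define G where "G = inv_into ?A star_coords"
  have G: "G y \<in> ?A" "star_coords (G y) = y" if "y \<in> ?S" for y
    unfolding G_def using that img by (simp_all add: inv_into_into f_inv_into_f)
  have GF: "G (star_coords \<nu>) = \<nu>" if "\<nu> \<in> ?A" for \<nu>
    unfolding G_def using inj that by (rule inv_into_f_f)
  have "continuous_on ?S (\<lambda>y. G y f)" for f
  proof (induction f rule: poly_factor_induct)
    case (const c)
    show ?case
      by (rule continuous_on_eq[OF continuous_on_const[of _ "trivial_norm c"]])
         (simp add: affine_lineD(6)[OF G(1)])
  next
    case (irreducible q)
    have "G y q = fst y ^ degree q * snd y q" if "y \<in> ?S" for y
    proof -
      have "fst (star_coords (G y)) = max 1 (G y [:0, 1:])" "snd (star_coords (G y)) q = min 1 (G y q)"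
        using irreducible by (simp_all add: star_coords_def)
      then show ?thesis
        using affine_line_irreducible_value[OF G(1)[OF that] irreducible] by (simp add: G(2)[OF that])
    qed
    moreover have "continuous_on ?S (\<lambda>y. fst y ^ degree q * snd y q)"
      by (intro continuous_intros continuous_on_star_coordinate)
    ultimately show ?case by (simp cong: continuous_on_cong)
  next
    case (mult f g)
    then have "continuous_on ?S (\<lambda>y. G y f * G y g)" by (rule continuous_on_mult)
    then show ?case by (simp add: affine_lineD(4)[OF G(1)] cong: continuous_on_cong)
  qed
  then have contG: "continuous_on ?S G" by (rule continuous_on_coordinatewise_then_product)
  have coord: "continuous_on ?A (\<lambda>\<nu>. \<nu> f)" for f
    using continuous_on_product_coordinates by (rule continuous_on_subset) simp
  have contF: "continuous_on ?A star_coords"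
    unfolding star_coords_def
  proof (intro continuous_on_Pair continuous_on_coordinatewise_then_product)
    show "continuous_on ?A (\<lambda>\<nu>. max 1 (\<nu> [:0, 1:]))"
      by (intro continuous_on_max continuous_on_const coord)
    show "continuous_on ?A (\<lambda>\<nu>. if q \<in> monic_irreducibles TYPE('a) then min 1 (\<nu> q) else 1)" for q
      by (cases "q \<in> monic_irreducibles TYPE('a)")
         (simp_all add: continuous_on_min continuous_on_const coord)
  qed
  have "homeomorphism ?A ?S star_coords G"
    using contF contG img G GF by (intro homeomorphismI) auto
  then show ?thesis by (auto simp: homeomorphic_def)
qed

lemma homeomorphic_space_affine_line_iff:
  "affine_line_topology TYPE('a::field) homeomorphic_space affine_line_topology TYPE('b::field)
    \<longleftrightarrow> affine_line TYPE('a) homeomorphic affine_line TYPE('b)"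
proof -
  have "top_of_set S homeomorphic_space top_of_set T \<longleftrightarrow> S homeomorphic T"
    for S :: "('a poly \<Rightarrow> real) set" and T :: "('b poly \<Rightarrow> real) set"
  proof
    assume "top_of_set S homeomorphic_space top_of_set T"
    then obtain f g where fg: "homeomorphic_maps (top_of_set S) (top_of_set T) f g"
      by (auto simp: homeomorphic_space_def)
    then have "homeomorphism S T f g"
      unfolding homeomorphic_maps_def
      by (intro homeomorphismI) (auto simp: continuous_map_in_subtopology)
    then show "S homeomorphic T" by (auto simp: homeomorphic_def)
  next
    assume "S homeomorphic T"
    then obtain f g where "homeomorphism S T f g" by (auto simp: homeomorphic_def)
    then have "homeomorphic_maps (top_of_set S) (top_of_set T) f g"
      unfolding homeomorphic_maps_def homeomorphism_def
      by (auto simp: continuous_map_in_subtopology)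
    then show "top_of_set S homeomorphic_space top_of_set T" by (auto simp: homeomorphic_space_def)
  qed
  then show ?thesis by (simp add: affine_line_topology_def euclidean_product_topology)
qed

lemma affine_lines_homeomorphic_iff:
  "affine_line_topology TYPE('a::field) homeomorphic_space affine_line_topology TYPE('b::field)
    \<longleftrightarrow> monic_irreducibles TYPE('a) \<approx> monic_irreducibles TYPE('b)"
proof -
  have "affine_line TYPE('a) homeomorphic affine_line TYPE('b) \<longleftrightarrow>
      star (monic_irreducibles TYPE('a)) homeomorphic star (monic_irreducibles TYPE('b))"
    using affine_line_homeomorphic_star[where 'a='a] affine_line_homeomorphic_star[where 'a='b]
    by (meson homeomorphic_sym homeomorphic_trans)
  also have "\<dots> \<longleftrightarrow> monic_irreducibles TYPE('a) \<approx> monic_irreducibles TYPE('b)"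
    by (rule star_homeomorphic_iff) (use linear_monic_irreducible in blast)+
  finally show ?thesis by (simp add: homeomorphic_space_affine_line_iff)
qed

text \<open>
  Part (a) reduces the other two parts to counting. An algebraically closed field is its own
  algebraic closure, so in (c) both sets of monic irreducibles are counted by the same lemma.
\<close>

theorem corollary2p2:
  fixes \<iota> :: "'a::field \<Rightarrow> 'c::alg_closed_field"
  shows
    "(affine_line_topology TYPE('a) homeomorphic_space affine_line_topology TYPE('b::field)
        \<longleftrightarrow> monic_irreducibles TYPE('a) \<approx> monic_irreducibles TYPE('b))
    \<and> (infinite (UNIV :: 'a set) \<and> infinite (UNIV :: 'b set) \<longrightarrow>
        (affine_line_topology TYPE('a) homeomorphic_space affine_line_topology TYPE('b)
          \<longleftrightarrow> (UNIV :: 'a set) \<approx> (UNIV :: 'b set)))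
    \<and> (is_algebraic_closure \<iota> \<longrightarrow>
        affine_line_topology TYPE('a) homeomorphic_space affine_line_topology TYPE('c))"
proof (intro conjI impI affine_lines_homeomorphic_iff)
  assume "infinite (UNIV :: 'a set) \<and> infinite (UNIV :: 'b set)"
  then have "monic_irreducibles TYPE('a) \<approx> (UNIV :: 'a set)"
    "monic_irreducibles TYPE('b) \<approx> (UNIV :: 'b set)"
    by (simp_all add: monic_irreducibles_eqpoll_infinite_field)
  then show "affine_line_topology TYPE('a) homeomorphic_space affine_line_topology TYPE('b)
      \<longleftrightarrow> (UNIV :: 'a set) \<approx> (UNIV :: 'b set)"
    unfolding affine_lines_homeomorphic_iff by (meson eqpoll_sym eqpoll_trans)
next
  assume "is_algebraic_closure \<iota>"
  then have "monic_irreducibles TYPE('a) \<approx> monic_irreducibles TYPE('c)"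
    using monic_irreducibles_eqpoll_algebraic_closure monic_irreducibles_eqpoll_alg_closed_field
    by (meson eqpoll_sym eqpoll_trans)
  then show "affine_line_topology TYPE('a) homeomorphic_space affine_line_topology TYPE('c)"
    by (simp add: affine_lines_homeomorphic_iff)
qed

end
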